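(* Let $0<\alpha<1/2$, and let $\mu$ be an $\alpha$-AD-regular probability measure on $A:=\operatorname{spt}(\mu)\subset[0,1]$. Define $$f(x,y,z)=x+(y-z)^2,\qquad\nu=f_\#(\mu\times\mu\times\mu).$$ For every fixed nonnegative Schwartz function $\varphi\not\equiv0$ on $\mathbb R$, put $\varphi_\delta(t):=\delta^{-1}\varphi(t/\delta)$. Then $$\|\varphi_\delta*\nu\|_{L^2(\mathbb R)}^2\gtrsim\delta^{2\alpha-1}$$ for all sufficiently small $\delta>0$, where the implicit positive constant does not depend on $\delta$. In particular, the left-hand side tends to infinity as $\delta\downarrow0$.
   Context: A probability measure $\mu$ is $\alpha$-AD-regular (Ahlfors--David regular) on its support if $\operatorname{diam}(\operatorname{spt}\mu)>0$ and there is $C_\mu>0$ such that $C_\mu^{-1}r^\alpha\le\mu(B(x,r))\le C_\mu r^\alpha$ for every $x\in\operatorname{spt}(\mu)$ and every $0<r\le\operatorname{diam}(\operatorname{spt}\mu)$. $f_\#(\mu\times\mu\times\mu)$ denotes the pushforward measure on $\mathbb R$. *)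

theory Defs
  imports "HOL-Probability.Probability"
begin

definition spt :: "'a::metric_space measure \<Rightarrow> 'a set" where
  "spt M = {x. \<forall>r>0. emeasure M (ball x r) > 0}"

text \<open>
  Balls are closed; open balls would only change the constant. The library's
  diameter is meaningful for bounded sets only, so this definition is to be used for
  measures with bounded support.
\<close>
definition AD_regular :: "real \<Rightarrow> 'a::metric_space measure \<Rightarrow> bool" where
  "AD_regular \<alpha> M \<longleftrightarrow>
     diameter (spt M) > 0 \<and>
     (\<exists>C>0. \<forall>x\<in>spt M. \<forall>r. 0 < r \<and> r \<le> diameter (spt M) \<longrightarrow>
        inverse C * r powr \<alpha> \<le> measure M (cball x r) \<and>
        measure M (cball x r) \<le> C * r powr \<alpha>)"

definition schwartz :: "(real \<Rightarrow> real) \<Rightarrow> bool" where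
  "schwartz \<phi> \<longleftrightarrow>
     (\<forall>j x. (deriv ^^ j) \<phi> differentiable at x) \<and>
     (\<forall>k j. \<exists>C. \<forall>x. \<bar>x ^ k * (deriv ^^ j) \<phi> x\<bar> \<le> C)"

definition rescale :: "real \<Rightarrow> (real \<Rightarrow> real) \<Rightarrow> real \<Rightarrow> real" where
  "rescale \<delta> \<phi> t = inverse \<delta> * \<phi> (t / \<delta>)"

definition fun_measure_conv :: "(real \<Rightarrow> real) \<Rightarrow> real measure \<Rightarrow> real \<Rightarrow> real" where
  "fun_measure_conv g M t = (\<integral>s. g (t - s) \<partial>M)"

text \<open>The squared norm takes the value \<open>\<infinity>\<close> for measurable functions outside \<open>L\<^sup>2\<close>.\<close>
definition L2_norm_sq :: "(real \<Rightarrow> real) \<Rightarrow> ennreal" where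
  "L2_norm_sq g = (\<integral>\<^sup>+t. ennreal ((g t)\<^sup>2) \<partial>lborel)"

definition f_map :: "real \<times> real \<times> real \<Rightarrow> real" where
  "f_map = (\<lambda>(x, y, z). x + (y - z)\<^sup>2)"

definition push_nu :: "real measure \<Rightarrow> real measure" where
  "push_nu M = distr (M \<Otimes>\<^sub>M (M \<Otimes>\<^sub>M M)) borel f_map"

end

theory Submission
  imports Defs "HOL-Real_Asymp.Real_Asymp"
begin

text \<open>
  If \<open>\<bar>y - z\<bar> \<le> \<surd>r\<close> then \<open>f(x,y,z)\<close> lies within \<open>r\<close> of \<open>x\<close>, and by regularity such pairs
  \<open>(y,z)\<close> have \<open>\<mu> \<times> \<mu>\<close>-measure at least a constant times \<open>r\<^bsup>\<alpha>/2\<^esup>\<close>. Hence at scale \<open>r \<sim> \<delta>\<close> the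
  measure \<open>\<nu>\<close> dominates \<open>r\<^bsup>\<alpha>/2\<^esup>\<mu>\<close>, so \<open>\<phi>\<^sub>\<delta> * \<nu>\<close> is bounded below by
  \<open>\<delta>\<^bsup>\<alpha>/2-1\<^esup>\<mu>(B(t,r))\<close>, up to a shift of \<open>t\<close>. By Tonelli and regularity the integral of
  \<open>\<mu>(B(t,r))\<^sup>2\<close> over \<open>t\<close> is at least a constant times \<open>r\<^bsup>1+\<alpha>\<^esup>\<close>, and the powers multiply to
  \<open>\<delta>\<^bsup>2\<alpha>-1\<^esup>\<close>.
\<close>

text \<open>A point outside the support has a null ball, and that ball contains a basis set around
  the point. The complement is thus covered by null members of a countable basis.\<close>

lemma AE_in_spt:
  fixes M :: "'a::{metric_space, second_countable_topology} measure"
  assumes "sets M = sets borel"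
  shows "AE x in M. x \<in> spt M"
proof -
  obtain B :: "'a set set" where B: "countable B" "topological_basis B"
    using ex_countable_basis by blast
  define N where "N = {b\<in>B. emeasure M b = 0}"
  have "b \<in> sets M" if "b \<in> B" for b
    using topological_basis_open[OF B(2) that] assms by auto
  hence "(\<Union>b\<in>N. b) \<in> null_sets M"
    using B(1) by (intro null_sets_UN') (auto simp: N_def null_sets_def)
  moreover have "x \<in> (\<Union>b\<in>N. b)" if "x \<notin> spt M" for x
  proof -
    from that obtain r where r: "r > 0" "emeasure M (ball x r) = 0"
      by (auto simp: spt_def)
    obtain b where b: "b \<in> B" "x \<in> b" "b \<subseteq> ball x r"
      using topological_basisE[OF B(2), of "ball x r" x] r(1) by auto
    have "emeasure M b \<le> emeasure M (ball x r)"
      using b(3) assms by (intro emeasure_mono) auto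
    with r b show ?thesis by (auto simp: N_def)
  qed
  ultimately show ?thesis
    by (intro AE_I'[of "\<Union>b\<in>N. b"]) auto
qed

section \<open>Mass estimates for the product measure and the push-forward\<close>

context
  fixes M :: "real measure"
  assumes prob: "prob_space M" and sets_M[measurable_cong]: "sets M = sets borel"
begin

interpretation prob_space M by (fact prob)

interpretation pair: pair_prob_space M M ..

interpretation triple: pair_prob_space M "M \<Otimes>\<^sub>M M" ..

lemma measurable_f_map [measurable]: "f_map \<in> borel_measurable (M \<Otimes>\<^sub>M (M \<Otimes>\<^sub>M M))"
  unfolding f_map_def split_beta by measurable

lemma prob_space_push_nu: "prob_space (push_nu M)"
  unfolding push_nu_def by (intro triple.prob_space_distr) measurable

lemma sets_near_diagonal: "{p. \<bar>fst p - snd p\<bar> \<le> r} \<in> sets (M \<Otimes>\<^sub>M M)"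
proof -
  have "{p \<in> space (M \<Otimes>\<^sub>M M). \<bar>fst p - snd p\<bar> \<le> r} \<in> sets (M \<Otimes>\<^sub>M M)"
    by measurable
  thus ?thesis
    using sets_eq_imp_space_eq[OF sets_M] by (simp add: space_pair_measure)
qed

text \<open>The slice of the strip over x is exactly \<open>cball x r\<close>. Integrating the slice
  masses gives the product measure, and the hypothesis covers almost every x because the support has
  full measure.\<close>

lemma emeasure_near_diagonal:
  assumes "\<And>x. x \<in> spt M \<Longrightarrow> b \<le> measure M (cball x r)"
  shows "ennreal b \<le> emeasure (M \<Otimes>\<^sub>M M) {p. \<bar>fst p - snd p\<bar> \<le> r}"
proof -
  have "ennreal b = (\<integral>\<^sup>+x. ennreal b \<partial>M)"
    by (simp add: emeasure_space_1)
  also have "\<dots> \<le> (\<integral>\<^sup>+x. emeasure M (cball x r) \<partial>M)"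
    using AE_in_spt[OF sets_M]
    by (intro nn_integral_mono_AE, elim AE_mp)
       (auto intro!: AE_I2 ennreal_leI assms simp: emeasure_eq_measure)
  also have "\<dots> = (\<integral>\<^sup>+x. emeasure M (Pair x -` {p. \<bar>fst p - snd p\<bar> \<le> r}) \<partial>M)"
    by (intro nn_integral_cong arg_cong2[where f = emeasure]) (auto simp: dist_real_def)
  also have "\<dots> = emeasure (M \<Otimes>\<^sub>M M) {p. \<bar>fst p - snd p\<bar> \<le> r}"
    by (rule emeasure_pair_measure_alt[symmetric, OF sets_near_diagonal])
  finally show ?thesis .
qed

text \<open>On the product of \<open>cball u (2 * r)\<close> with the strip of half-width
  \<open>sqrt r\<close>, the square term shifts x by at most r, so \<open>f_map\<close> lands in
  \<open>cball u (3 * r)\<close>. The measure of this product set factorises.\<close>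

lemma measure_push_nu_cball_ge:
  assumes b: "\<And>x. x \<in> spt M \<Longrightarrow> b \<le> measure M (cball x (sqrt r))" and "0 \<le> b" "0 \<le> r"
  shows "b * measure M (cball u (2 * r)) \<le> measure (push_nu M) (cball u (3 * r))"
proof -
  interpret nu: prob_space "push_nu M" by (rule prob_space_push_nu)
  let ?D = "{p::real \<times> real. \<bar>fst p - snd p\<bar> \<le> sqrt r}"
  have space_M: "space M = UNIV"
    using sets_eq_imp_space_eq[OF sets_M] by simp
  have "ennreal (b * measure M (cball u (2 * r)))
      = emeasure M (cball u (2 * r)) * ennreal b"
    using \<open>0 \<le> b\<close> by (simp add: emeasure_eq_measure ennreal_mult mult.commute)
  also have "\<dots> \<le> emeasure M (cball u (2 * r)) * emeasure (M \<Otimes>\<^sub>M M) ?D"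
    by (intro mult_left_mono emeasure_near_diagonal b) auto
  also have "\<dots> = emeasure (M \<Otimes>\<^sub>M (M \<Otimes>\<^sub>M M)) (cball u (2 * r) \<times> ?D)"
    using sets_near_diagonal by (intro pair.emeasure_pair_measure_Times[symmetric]) (auto simp: sets_M)
  also have "\<dots> \<le> emeasure (M \<Otimes>\<^sub>M (M \<Otimes>\<^sub>M M))
      (f_map -` cball u (3 * r) \<inter> space (M \<Otimes>\<^sub>M (M \<Otimes>\<^sub>M M)))"
  proof (rule emeasure_mono)
    have "f_map (x, y, z) \<in> cball u (3 * r)"
      if x: "x \<in> cball u (2 * r)" and yz: "\<bar>y - z\<bar> \<le> sqrt r" for x y z
    proof -
      have "(y - z)\<^sup>2 \<le> r"
        using power_mono[OF yz, of 2] \<open>0 \<le> r\<close> by simp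
      moreover have "\<bar>u - x\<bar> \<le> 2 * r"
        using x by (simp add: dist_real_def)
      moreover have "0 \<le> (y - z)\<^sup>2" by simp
      ultimately have "\<bar>u - (x + (y - z)\<^sup>2)\<bar> \<le> 3 * r"
        by linarith
      thus ?thesis by (simp add: f_map_def dist_real_def)
    qed
    thus "cball u (2 * r) \<times> ?D
        \<subseteq> f_map -` cball u (3 * r) \<inter> space (M \<Otimes>\<^sub>M (M \<Otimes>\<^sub>M M))"
      by (auto simp: space_pair_measure space_M simp del: mem_cball)
  qed measurable
  also have "\<dots> = emeasure (push_nu M) (cball u (3 * r))"
    unfolding push_nu_def by (rule emeasure_distr[symmetric]) measurable
  finally show ?thesis
    by (simp add: nu.emeasure_eq_measure)
qed

text \<open>Allows a constant to be pulled out of the integral over t later. The ball mass is the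
  mass of a slice of a measurable set in the product, hence measurable in t.\<close>

lemma measurable_measure_cball:
  "(\<lambda>t. measure M (cball (t - a) s)) \<in> borel_measurable borel"
proof -
  have "{p \<in> space (borel \<Otimes>\<^sub>M M). \<bar>fst p - a - snd p\<bar> \<le> s} \<in> sets (borel \<Otimes>\<^sub>M M)"
    by measurable
  hence "(\<lambda>t. emeasure M (Pair t -` {p \<in> space (borel \<Otimes>\<^sub>M M). \<bar>fst p - a - snd p\<bar> \<le> s}))
      \<in> borel_measurable borel"
    by (rule measurable_emeasure_Pair)
  also have "(\<lambda>t. emeasure M (Pair t -` {p \<in> space (borel \<Otimes>\<^sub>M M). \<bar>fst p - a - snd p\<bar> \<le> s}))
      = (\<lambda>t. emeasure M (cball (t - a) s))"
    using sets_eq_imp_space_eq[OF sets_M]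
    by (intro ext arg_cong2[where f = emeasure]) (auto simp: space_pair_measure dist_real_def)
  finally show ?thesis unfolding measure_def by measurable
qed

text \<open>Integrate the constant b over the pairs (t, x) with x within r of t - a. Integrating in
  t first yields the length 2r; integrating in x first yields at most the squared ball mass. The
  shift a makes room for a bump not centred at 0.\<close>

lemma nn_integral_measure_cball_sq_ge:
  assumes b: "\<And>x. x \<in> spt M \<Longrightarrow> b \<le> measure M (cball x r)" and "0 \<le> b" "0 \<le> r"
  shows "ennreal (2 * r * b) \<le> (\<integral>\<^sup>+t. ennreal ((measure M (cball (t - a) (2 * r)))\<^sup>2) \<partial>lborel)"
proof -
  interpret L: pair_sigma_finite lborel M
    by (intro pair_sigma_finite.intro sigma_finite_lborel sigma_finite_measure_axioms)
  have "ennreal (2 * r * b) = (\<integral>\<^sup>+x. ennreal (2 * r * b) \<partial>M)"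
    by (simp add: emeasure_space_1)
  also have "\<dots> = (\<integral>\<^sup>+x. (\<integral>\<^sup>+t. ennreal b * indicator (cball (x + a) r) t \<partial>lborel) \<partial>M)"
    using \<open>0 \<le> r\<close> \<open>0 \<le> b\<close>
    by (intro nn_integral_cong)
       (simp add: nn_integral_cmult cball_eq_atLeastAtMost ennreal_mult mult.commute)
  \<comment> \<open>As a condition on \<open>t - a - x\<close> the integrand is visibly jointly
    measurable, as the exchange of integrals requires.\<close>
  also have "\<dots> = (\<integral>\<^sup>+x. (\<integral>\<^sup>+t. (if \<bar>t - a - x\<bar> \<le> r then ennreal b else 0) \<partial>lborel) \<partial>M)"
    by (intro nn_integral_cong)
       (auto simp: indicator_def dist_real_def abs_le_iff)
  also have "\<dots> = (\<integral>\<^sup>+t. (\<integral>\<^sup>+x. (if \<bar>t - a - x\<bar> \<le> r then ennreal b else 0) \<partial>M) \<partial>lborel)"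
    by (rule L.Fubini') measurable
  also have "\<dots> \<le> (\<integral>\<^sup>+t. ennreal ((measure M (cball (t - a) (2 * r)))\<^sup>2) \<partial>lborel)"
  proof (rule nn_integral_mono)
    fix t
    define m where "m = measure M (cball (t - a) (2 * r))"
    \<comment> \<open>The radius is doubled so that the r-ball about any such x fits inside the ball
      about t - a.\<close>
    have m_ge: "(if \<bar>t - a - x\<bar> \<le> r then b else 0) \<le> m" if "x \<in> spt M" for x
    proof (cases "\<bar>t - a - x\<bar> \<le> r")
      case True
      have "b \<le> measure M (cball x r)" by (rule b[OF that])
      also have "\<dots> \<le> m"
        unfolding m_def using True
        by (intro finite_measure_mono) (auto simp: sets_M dist_real_def)
      finally show ?thesis using True by simp
    qed (simp add: m_def)
    \<comment> \<open>One factor m bounds the integrand, the other is the mass of the ball that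
      carries it.\<close>
    have "(\<integral>\<^sup>+x. (if \<bar>t - a - x\<bar> \<le> r then ennreal b else 0) \<partial>M)
        \<le> (\<integral>\<^sup>+x. ennreal m * indicator (cball (t - a) (2 * r)) x \<partial>M)"
    proof (rule nn_integral_mono_AE)
      show "AE x in M. (if \<bar>t - a - x\<bar> \<le> r then ennreal b else 0)
          \<le> ennreal m * indicator (cball (t - a) (2 * r)) x"
        using AE_in_spt[OF sets_M]
      proof eventually_elim
        case (elim x)
        show ?case
          using m_ge[OF elim] \<open>0 \<le> r\<close> by (auto simp: indicator_def dist_real_def intro!: ennreal_leI)
      qed
    qed
    also have "\<dots> = ennreal m * emeasure M (cball (t - a) (2 * r))"
      by (rule nn_integral_cmult_indicator) (simp add: sets_M)
    also have "\<dots> = ennreal ((measure M (cball (t - a) (2 * r)))\<^sup>2)"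
      by (simp add: emeasure_eq_measure m_def power2_eq_square ennreal_mult)
    finally show "(\<integral>\<^sup>+x. (if \<bar>t - a - x\<bar> \<le> r then ennreal b else 0) \<partial>M)
        \<le> ennreal ((measure M (cball (t - a) (2 * r)))\<^sup>2)" .
  qed
  finally show ?thesis .
qed

end

section \<open>Bumps of a Schwartz function and pointwise bounds for convolutions\<close>

lemma schwartz_continuous: "schwartz \<phi> \<Longrightarrow> continuous_on UNIV \<phi>"
  unfolding schwartz_def
  by (metis continuous_at_imp_continuous_on differentiable_imp_continuous_within funpow_0)

lemma schwartz_bounded:
  assumes "schwartz \<phi>"
  shows "\<exists>B. \<forall>x. \<bar>\<phi> x\<bar> \<le> B"
proof -
  have "\<exists>B. \<forall>x. \<bar>x ^ 0 * (deriv ^^ 0) \<phi> x\<bar> \<le> B"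
    using assms unfolding schwartz_def by blast
  thus ?thesis by simp
qed

text \<open>Around a point of positivity, continuity keeps \<phi> above half its value there;
  halving the radius makes the interval closed.\<close>

lemma positive_bump:
  fixes \<phi> :: "real \<Rightarrow> real"
  assumes "continuous_on UNIV \<phi>" "\<And>t. \<phi> t \<ge> 0" "\<exists>t. \<phi> t \<noteq> 0"
  obtains t\<^sub>0 \<epsilon> k where "\<epsilon> > 0" "k > 0" "\<And>t. \<bar>t - t\<^sub>0\<bar> \<le> \<epsilon> \<Longrightarrow> k \<le> \<phi> t"
proof -
  obtain t\<^sub>0 where "\<phi> t\<^sub>0 \<noteq> 0" using assms(3) by blast
  hence pos: "\<phi> t\<^sub>0 > 0" using assms(2)[of t\<^sub>0] by simp
  obtain d where d: "d > 0" "\<And>t. dist t t\<^sub>0 < d \<Longrightarrow> dist (\<phi> t) (\<phi> t\<^sub>0) < \<phi> t\<^sub>0 / 2"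
    using assms(1) pos unfolding continuous_on_iff by (metis UNIV_I half_gt_zero)
  show ?thesis
  proof (rule that[of "d / 2" "\<phi> t\<^sub>0 / 2" t\<^sub>0])
    fix t assume "\<bar>t - t\<^sub>0\<bar> \<le> d / 2"
    hence "dist (\<phi> t) (\<phi> t\<^sub>0) < \<phi> t\<^sub>0 / 2"
      using d by (intro d(2)) (auto simp: dist_real_def)
    thus "\<phi> t\<^sub>0 / 2 \<le> \<phi> t" unfolding dist_real_def by linarith
  qed (use d pos in auto)
qed

text \<open>For s in the ball, (t - s)/\<delta> falls in the bump interval, so the rescaled function
  is at least k/\<delta>; elsewhere it is nonnegative.\<close>

lemma fun_measure_conv_rescale_ge:
  assumes "prob_space N" and sets_N[measurable_cong]: "sets N = sets borel"
    and cont: "continuous_on UNIV \<phi>" and bdd: "\<And>t. \<bar>\<phi> t\<bar> \<le> B" and nonneg: "\<And>t. \<phi> t \<ge> 0"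
    and k: "\<And>t. \<bar>t - t\<^sub>0\<bar> \<le> \<epsilon> \<Longrightarrow> k \<le> \<phi> t" and "\<delta> > 0"
  shows "inverse \<delta> * k * measure N (cball (t - \<delta> * t\<^sub>0) (\<delta> * \<epsilon>)) \<le> fun_measure_conv (rescale \<delta> \<phi>) N t"
proof -
  interpret prob_space N by fact
  have [measurable]: "\<phi> \<in> borel_measurable borel"
    using cont by (rule borel_measurable_continuous_onI)
  let ?S = "cball (t - \<delta> * t\<^sub>0) (\<delta> * \<epsilon>)"
  have "inverse \<delta> * k * measure N ?S = (\<integral>s. inverse \<delta> * k * indicator ?S s \<partial>N)"
    using sets_eq_imp_space_eq[OF sets_N] by simp
  also have "\<dots> \<le> (\<integral>s. rescale \<delta> \<phi> (t - s) \<partial>N)"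
  proof (rule integral_mono)
    show "integrable N (\<lambda>s. inverse \<delta> * k * indicator ?S s)"
      by (intro integrable_mult_right integrable_real_indicator)
         (auto simp: sets_N emeasure_eq_measure)
    \<comment> \<open>A Bochner integral defaults to 0 without integrability; here a bounded
      function meets a finite measure.\<close>
    show "integrable N (\<lambda>s. rescale \<delta> \<phi> (t - s))"
      unfolding rescale_def
      by (intro integrable_mult_right integrable_const_bound[where B = B]) (auto simp: bdd)
    fix s
    show "inverse \<delta> * k * indicator ?S s \<le> rescale \<delta> \<phi> (t - s)"
    proof (cases "s \<in> ?S")
      case True
      have "(t - s) / \<delta> - t\<^sub>0 = (t - \<delta> * t\<^sub>0 - s) / \<delta>"
        using \<open>\<delta> > 0\<close> by (simp add: field_simps)
      hence "\<bar>(t - s) / \<delta> - t\<^sub>0\<bar> \<le> \<epsilon>"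
        using True \<open>\<delta> > 0\<close> by (simp add: dist_real_def abs_divide pos_divide_le_eq mult.commute)
      from k[OF this] True \<open>\<delta> > 0\<close> show ?thesis
        by (simp add: rescale_def mult_left_mono)
    qed (use nonneg \<open>\<delta> > 0\<close> in \<open>auto simp: rescale_def\<close>)
  qed
  finally show ?thesis by (simp add: fun_measure_conv_def)
qed

text \<open>With r = \<delta>\<epsilon>, the convolution dominates a constant \<open>K\<close> times
  the mass of a 2r-ball; squaring and integrating gives the bound. The bump has half-width
  3\<epsilon> to match the 3r-ball of the push-forward. Regularity is applied at radius
  \<open>sqrt r\<close> for the strip and at radius r for the integral, whence the two smallness
  conditions.\<close>

lemma L2_norm_sq_conv_push_nu_ge:
  assumes M: "prob_space M" "sets M = sets borel"
    and reg: "\<And>x r. x \<in> spt M \<Longrightarrow> 0 < r \<Longrightarrow> r \<le> R \<Longrightarrow> c * r powr \<alpha> \<le> measure M (cball x r)"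
    and "c > 0" "\<And>t. \<bar>\<phi> t\<bar> \<le> B" "continuous_on UNIV \<phi>" "\<And>t. \<phi> t \<ge> 0"
    and k: "\<And>t. \<bar>t - t\<^sub>0\<bar> \<le> 3 * \<epsilon> \<Longrightarrow> k \<le> \<phi> t" and "k > 0" "\<epsilon> > 0" "\<delta> > 0"
    and small: "\<delta> * \<epsilon> \<le> R" "sqrt (\<delta> * \<epsilon>) \<le> R"
  shows "ennreal (2 * k\<^sup>2 * c ^ 3 * \<epsilon> powr (1 + 2 * \<alpha>) * \<delta> powr (2 * \<alpha> - 1))
    \<le> L2_norm_sq (fun_measure_conv (rescale \<delta> \<phi>) (push_nu M))"
proof -
  define r where "r = \<delta> * \<epsilon>"
  have r: "r > 0" using assms by (simp add: r_def)
  \<comment> \<open>Height of the rescaled bump times the lower bound for the mass of the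
    strip.\<close>
  define K where "K = inverse \<delta> * k * (c * sqrt r powr \<alpha>)"
  have "K > 0" using assms r by (simp add: K_def)
  let ?F = "fun_measure_conv (rescale \<delta> \<phi>) (push_nu M)"
  let ?m = "\<lambda>t. measure M (cball (t - \<delta> * t\<^sub>0) (2 * r))"
  have lower: "K * ?m t \<le> ?F t" for t
  proof -
    have "K * ?m t = inverse \<delta> * k * (c * sqrt r powr \<alpha> * ?m t)"
      by (simp add: K_def mult_ac)
    also have "\<dots> \<le> inverse \<delta> * k * measure (push_nu M) (cball (t - \<delta> * t\<^sub>0) (3 * r))"
      using assms r
      by (intro mult_left_mono measure_push_nu_cball_ge[OF M] reg) (auto simp: r_def)
    also have "\<dots> = inverse \<delta> * k * measure (push_nu M) (cball (t - \<delta> * t\<^sub>0) (\<delta> * (3 * \<epsilon>)))"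
      by (simp add: r_def mult_ac)
    also have "\<dots> \<le> ?F t"
      using assms
      by (intro fun_measure_conv_rescale_ge[where B = B] prob_space_push_nu[OF M])
         (auto simp: push_nu_def)
    finally show ?thesis .
  qed
  have sqrt_sq: "(sqrt r powr \<alpha>)\<^sup>2 = r powr \<alpha>"
    using r by (simp add: powr_mult[symmetric] power2_eq_square)
  have r1: "r * r powr \<alpha> * r powr \<alpha> = r powr (1 + 2 * \<alpha>)"
  proof -
    have "r powr 1 * r powr \<alpha> * r powr \<alpha> = r powr (1 + 2 * \<alpha>)"
      unfolding powr_add[symmetric] by (simp add: algebra_simps)
    thus ?thesis using r by simp
  qed
  have r2: "r powr (1 + 2 * \<alpha>) = \<epsilon> powr (1 + 2 * \<alpha>) * \<delta> powr (1 + 2 * \<alpha>)"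
    using assms by (simp add: r_def powr_mult mult.commute)
  have \<delta>: "inverse \<delta> ^ 2 * \<delta> powr (1 + 2 * \<alpha>) = \<delta> powr (2 * \<alpha> - 1)"
  proof -
    have "\<delta> powr (2 * \<alpha> - 1) * \<delta> powr 2 = \<delta> powr (1 + 2 * \<alpha>)"
      unfolding powr_add[symmetric] by (simp add: algebra_simps)
    hence "\<delta> powr (1 + 2 * \<alpha>) = \<delta> powr (2 * \<alpha> - 1) * \<delta>\<^sup>2"
      using \<open>\<delta> > 0\<close> by simp
    thus ?thesis using \<open>\<delta> > 0\<close> by (simp add: field_simps)
  qed
  \<comment> \<open>Two factors c come from the square of \<open>K\<close> and one from the integral
    of squared ball masses. The powers of r combine to 1 + 2\<alpha>, and \<delta> loses two powers
    through the bump height.\<close>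
  have "K\<^sup>2 * (2 * r * (c * r powr \<alpha>))
      = 2 * k\<^sup>2 * c ^ 3 * (inverse \<delta> ^ 2 * (r * r powr \<alpha> * (sqrt r powr \<alpha>)\<^sup>2))"
    by (simp add: K_def power_mult_distrib power2_eq_square power3_eq_cube mult_ac)
  also have "\<dots> = 2 * k\<^sup>2 * c ^ 3 * \<epsilon> powr (1 + 2 * \<alpha>)
      * (inverse \<delta> ^ 2 * \<delta> powr (1 + 2 * \<alpha>))"
    unfolding sqrt_sq r1 r2 by (simp only: mult_ac)
  finally have "K\<^sup>2 * (2 * r * (c * r powr \<alpha>))
      = 2 * k\<^sup>2 * c ^ 3 * \<epsilon> powr (1 + 2 * \<alpha>) * \<delta> powr (2 * \<alpha> - 1)"
    unfolding \<delta> .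
  hence "ennreal (2 * k\<^sup>2 * c ^ 3 * \<epsilon> powr (1 + 2 * \<alpha>) * \<delta> powr (2 * \<alpha> - 1))
      = ennreal (K\<^sup>2 * (2 * r * (c * r powr \<alpha>)))"
    by (simp only:)
  also have "\<dots> = ennreal (K\<^sup>2) * ennreal (2 * r * (c * r powr \<alpha>))"
    using \<open>c > 0\<close> r by (intro ennreal_mult) auto
  also have "\<dots> \<le> ennreal (K\<^sup>2) * (\<integral>\<^sup>+t. ennreal ((?m t)\<^sup>2) \<partial>lborel)"
    using assms r
    by (intro mult_left_mono nn_integral_measure_cball_sq_ge[OF M] reg) (auto simp: r_def)
  also have "\<dots> = (\<integral>\<^sup>+t. ennreal (K\<^sup>2) * ennreal ((?m t)\<^sup>2) \<partial>lborel)"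
  proof -
    note [measurable] = measurable_measure_cball[OF M, of "\<delta> * t\<^sub>0" "2 * r"]
    show ?thesis by (intro nn_integral_cmult[symmetric]) measurable
  qed
  also have "\<dots> \<le> (\<integral>\<^sup>+t. ennreal ((?F t)\<^sup>2) \<partial>lborel)"
    using lower \<open>K > 0\<close>
    by (intro nn_integral_mono)
       (auto simp flip: ennreal_mult power_mult_distrib intro!: ennreal_leI power_mono)
  finally show ?thesis by (simp add: L2_norm_sq_def)
qed

section \<open>Divergence and the choice of constants\<close>

lemma powr_neg_tendsto_top:
  fixes c p :: real
  assumes "c > 0" "p < 0"
  shows "((\<lambda>\<delta>. ennreal (c * \<delta> powr p)) \<longlongrightarrow> \<infinity>) (at_right 0)"
proof -
  have "filterlim (\<lambda>\<delta>. c * \<delta> powr p) at_top (at_right 0)"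
    using assms by real_asymp
  thus ?thesis
    by (simp add: ennreal_tendsto_top_eq_at_top)
qed

theorem proposition5p1:
  fixes \<alpha> :: real and \<mu> :: "real measure" and \<phi> :: "real \<Rightarrow> real"
  assumes "0 < \<alpha>" and "\<alpha> < 1 / 2"
    and "prob_space \<mu>" and "sets \<mu> = sets borel"
    and "AD_regular \<alpha> \<mu>"
    and "spt \<mu> \<subseteq> {0..1}"
    and "schwartz \<phi>" and "\<And>t. \<phi> t \<ge> 0" and "\<exists>t. \<phi> t \<noteq> 0"
  shows "(\<exists>c>0. \<exists>\<delta>\<^sub>0>0. \<forall>\<delta>. 0 < \<delta> \<and> \<delta> < \<delta>\<^sub>0 \<longrightarrow>
            ennreal (c * \<delta> powr (2 * \<alpha> - 1))
              \<le> L2_norm_sq (fun_measure_conv (rescale \<delta> \<phi>) (push_nu \<mu>)))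
       \<and> ((\<lambda>\<delta>. L2_norm_sq (fun_measure_conv (rescale \<delta> \<phi>) (push_nu \<mu>))) \<longlongrightarrow> \<infinity>) (at_right 0)"
proof -
  let ?L = "\<lambda>\<delta>. L2_norm_sq (fun_measure_conv (rescale \<delta> \<phi>) (push_nu \<mu>))"
  define R where "R = diameter (spt \<mu>)"
  obtain C where "R > 0" "C > 0"
    and reg: "\<And>x r. x \<in> spt \<mu> \<Longrightarrow> 0 < r \<Longrightarrow> r \<le> R
      \<Longrightarrow> inverse C * r powr \<alpha> \<le> measure \<mu> (cball x r)"
    using \<open>AD_regular \<alpha> \<mu>\<close> unfolding AD_regular_def R_def by blast
  have cont: "continuous_on UNIV \<phi>" by (rule schwartz_continuous) fact
  obtain B where B: "\<And>t. \<bar>\<phi> t\<bar> \<le> B" using schwartz_bounded[OF \<open>schwartz \<phi>\<close>] by auto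
  obtain t\<^sub>0 \<epsilon>' k where "\<epsilon>' > 0" "k > 0" and k': "\<And>t. \<bar>t - t\<^sub>0\<bar> \<le> \<epsilon>' \<Longrightarrow> k \<le> \<phi> t"
    by (rule positive_bump[OF cont assms(8,9)]) (rule that)
  define \<epsilon> where "\<epsilon> = \<epsilon>' / 3"
  have "\<epsilon> > 0" and k: "\<And>t. \<bar>t - t\<^sub>0\<bar> \<le> 3 * \<epsilon> \<Longrightarrow> k \<le> \<phi> t"
    using \<open>\<epsilon>' > 0\<close> k' by (auto simp: \<epsilon>_def)
  define c where "c = 2 * k\<^sup>2 * inverse C ^ 3 * \<epsilon> powr (1 + 2 * \<alpha>)"
  \<comment> \<open>The entry R keeps \<delta>\<epsilon> below R, and the entry
    \<open>R\<^sup>2\<close> does the same for its square root.\<close>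
  define \<delta>\<^sub>0 where "\<delta>\<^sub>0 = min R (R\<^sup>2) / \<epsilon>"
  have "c > 0" "\<delta>\<^sub>0 > 0"
    using \<open>k > 0\<close> \<open>C > 0\<close> \<open>\<epsilon> > 0\<close> \<open>R > 0\<close> by (auto simp: c_def \<delta>\<^sub>0_def)
  have bound: "ennreal (c * \<delta> powr (2 * \<alpha> - 1)) \<le> ?L \<delta>" if "0 < \<delta>" "\<delta> < \<delta>\<^sub>0" for \<delta>
  proof -
    have "\<delta> * \<epsilon> < min R (R\<^sup>2)"
      using that \<open>\<epsilon> > 0\<close> by (simp add: \<delta>\<^sub>0_def pos_less_divide_eq)
    hence "\<delta> * \<epsilon> \<le> R" "sqrt (\<delta> * \<epsilon>) \<le> R"
      using \<open>R > 0\<close> by (auto intro: real_le_lsqrt)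
    thus ?thesis
      unfolding c_def using assms B cont k reg that \<open>C > 0\<close> \<open>k > 0\<close> \<open>\<epsilon> > 0\<close>
      by (intro L2_norm_sq_conv_push_nu_ge[where R = R and B = B and t\<^sub>0 = t\<^sub>0]) auto
  qed
  moreover have "(?L \<longlongrightarrow> \<infinity>) (at_right 0)"
  \<comment> \<open>Since \<alpha> < 1/2, the exponent 2\<alpha> - 1 is negative and the lower bound
    diverges; the upper function is the constant \<infinity>.\<close>
  proof (rule tendsto_sandwich[OF _ _ powr_neg_tendsto_top tendsto_const])
    show "\<forall>\<^sub>F \<delta> in at_right 0. ennreal (c * \<delta> powr (2 * \<alpha> - 1)) \<le> ?L \<delta>"
      by (auto intro!: eventually_at_rightI[OF _ \<open>\<delta>\<^sub>0 > 0\<close>] bound)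
  qed (use \<open>c > 0\<close> \<open>\<alpha> < 1 / 2\<close> in auto)
  ultimately show ?thesis using \<open>c > 0\<close> \<open>\<delta>\<^sub>0 > 0\<close> by blast
qed

end
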